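(* Let $p$ be any remote point of $\mathbb Q$, let $X=\beta\mathbb Q\setminus\{p\}$, and let $Y=\mathbb N\cup\{\infty\}$ be the one-point compactification of the discrete space $\mathbb N$. Then the space $X$ is cellular-compact, but the product space $X\times Y$ is not cellular-compact.
   Context: A (Hausdorff) space $X$ is cellular-compact if for every family $\mathcal U$ of pairwise disjoint nonempty open subsets of $X$ there is a compact subspace $K\subset X$ such that $K\cap U\neq\emptyset$ for every $U\in\mathcal U$. $\mathbb Q$ carries its usual topology and $\beta$ denotes the Stone–Čech compactification. A point $p\in\beta Z\setminus Z$ is a remote point of a Tychonoff space $Z$ if $p\notin \mathrm{cl}_{\beta Z}(N)$ for every nowhere dense set $N\subset Z$. *)

theory Defs
  imports "HOL-Analysis.Analysis"
begin

text \<open>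
  All spaces are Hausdorff by convention. This is not made part of the definition below, so that
  the failure of cellular-compactness cannot be due to a failure of separation; subspaces
  of the Stone-Cech compactification are Hausdorff by lemma \<open>Hausdorff_space_stone_cech\<close> below.
\<close>

definition cellular_compact_space :: "'a topology \<Rightarrow> bool" where
  "cellular_compact_space X \<longleftrightarrow>
     (\<forall>\<U>. (\<forall>U\<in>\<U>. openin X U \<and> U \<noteq> {}) \<and> pairwise disjnt \<U> \<longrightarrow>
        (\<exists>K. compactin X K \<and> (\<forall>U\<in>\<U>. K \<inter> U \<noteq> {})))"

definition nowhere_dense_in :: "'a topology \<Rightarrow> 'a set \<Rightarrow> bool" where
  "nowhere_dense_in Z N \<longleftrightarrow> N \<subseteq> topspace Z \<and> Z interior_of (Z closure_of N) = {}"

text \<open>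
  The Stone-Cech compactification of a Tychonoff space \<open>Z\<close>, constructed as the closure of the image
  of \<open>Z\<close> under the evaluation map into the cube \<open>[0,1]\<^sup>C\<close>, where \<open>C\<close> is the set of continuous
  functions from \<open>Z\<close> to \<open>[0,1]\<close> (taken extensional, so that each function occurs once as an index).
  A subset \<open>S\<close> of \<open>Z\<close> is identified with the subset \<open>stone_cech_embed Z ` S\<close> of the
  compactification.
\<close>

definition unit_maps :: "'a topology \<Rightarrow> ('a \<Rightarrow> real) set" where
  "unit_maps Z = {f \<in> extensional (topspace Z). continuous_map Z (top_of_set {0..1}) f}"

definition unit_cube :: "'a topology \<Rightarrow> (('a \<Rightarrow> real) \<Rightarrow> real) topology" where
  "unit_cube Z = product_topology (\<lambda>_. top_of_set {0..1}) (unit_maps Z)"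

definition stone_cech_embed :: "'a topology \<Rightarrow> 'a \<Rightarrow> ('a \<Rightarrow> real) \<Rightarrow> real" where
  "stone_cech_embed Z x = (\<lambda>f\<in>unit_maps Z. f x)"

definition stone_cech :: "'a topology \<Rightarrow> (('a \<Rightarrow> real) \<Rightarrow> real) topology" where
  "stone_cech Z =
     subtopology (unit_cube Z) (unit_cube Z closure_of (stone_cech_embed Z ` topspace Z))"

text \<open>Intended for Tychonoff \<open>Z\<close>, where \<open>stone_cech_embed Z\<close> is a dense embedding (see below).\<close>

definition remote_point :: "'a topology \<Rightarrow> (('a \<Rightarrow> real) \<Rightarrow> real) \<Rightarrow> bool" where
  "remote_point Z p \<longleftrightarrow>
     p \<in> topspace (stone_cech Z) - stone_cech_embed Z ` topspace Z \<and>
     (\<forall>N. nowhere_dense_in Z N \<longrightarrow> p \<notin> stone_cech Z closure_of (stone_cech_embed Z ` N))"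

text \<open>The rationals, as a subspace of the real line (the type \<open>rat\<close> carries no topology).\<close>

abbreviation rat_space :: "real topology" where
  "rat_space \<equiv> top_of_set \<rat>"

text \<open>The characteristic properties of the Stone-Cech compactification.\<close>

lemma compact_space_unit_cube: "compact_space (unit_cube Z)"
  unfolding unit_cube_def compact_space_product_topology
  by (intro disjI2 ballI compact_space_subtopology) simp

lemma compact_space_stone_cech: "compact_space (stone_cech Z)"
  unfolding stone_cech_def
  by (rule compact_space_subtopology, rule closedin_compact_space)
     (simp_all add: compact_space_unit_cube)

lemma Hausdorff_space_stone_cech: "Hausdorff_space (stone_cech Z)"
  unfolding stone_cech_def unit_cube_def
  by (simp add: Hausdorff_space_subtopology Hausdorff_space_product_topology)

lemma stone_cech_embed_in_unit_cube:
  assumes "x \<in> topspace Z"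
  shows "stone_cech_embed Z x \<in> topspace (unit_cube Z)"
proof -
  have "f x \<in> {0..1}" if "f \<in> unit_maps Z" for f
    using that assms continuous_map_image_subset_topspace [of Z "top_of_set {0..1}" f]
    by (fastforce simp: unit_maps_def)
  then show ?thesis
    unfolding stone_cech_embed_def unit_cube_def topspace_product_topology
    by (intro restrict_PiE_iff [THEN iffD2]) simp
qed

lemma stone_cech_embed_subset_closure:
  "stone_cech_embed Z ` topspace Z \<subseteq> unit_cube Z closure_of (stone_cech_embed Z ` topspace Z)"
  by (intro closure_of_subset image_subsetI stone_cech_embed_in_unit_cube)

lemma stone_cech_embed_dense:
  "stone_cech Z closure_of (stone_cech_embed Z ` topspace Z) = topspace (stone_cech Z)"
  using stone_cech_embed_subset_closure [of Z] closure_of_subset_topspace [of "unit_cube Z"]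
  by (simp add: stone_cech_def closure_of_subtopology Int_absorb1 Int_absorb2)

lemma unit_maps_eq:
  "unit_maps Z = mspace (submetric (cfunspace Z euclidean_metric) {f. f \<in> topspace Z \<rightarrow> {0..1}})"
proof -
  have "bounded (f ` topspace Z)" if "f \<in> topspace Z \<rightarrow> {0..1}" for f :: "'a \<Rightarrow> real"
    using that by (intro bounded_subset [OF bounded_closed_interval [of 0 1]]) auto
  then show ?thesis
    unfolding unit_maps_def continuous_map_in_subtopology image_subset_iff_funcset
    by (intro set_eqI) (simp, metis)
qed

lemma embedding_map_stone_cech_embed:
  assumes "completely_regular_space Z" "Hausdorff_space Z"
  shows "embedding_map Z (stone_cech Z) (stone_cech_embed Z)"
proof -
  have "embedding_map Z (unit_cube Z) (stone_cech_embed Z)"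
    using completely_regular_space_cube_embedding_explicit [OF assms]
    by (simp only: unit_cube_def stone_cech_embed_def [abs_def] unit_maps_eq)
  then show ?thesis
    using stone_cech_embed_subset_closure by (simp add: stone_cech_def embedding_map_in_subtopology)
qed

lemma stone_cech_extension:
  assumes "continuous_map Z (top_of_set {0..1::real}) f"
  shows "\<exists>g. continuous_map (stone_cech Z) (top_of_set {0..1}) g \<and>
             (\<forall>x\<in>topspace Z. g (stone_cech_embed Z x) = f x)"
proof (intro exI conjI ballI)
  let ?f = "restrict f (topspace Z)"
  have f: "?f \<in> unit_maps Z"
    using continuous_map_eq [OF assms, of ?f] by (simp add: unit_maps_def)
  show "continuous_map (stone_cech Z) (top_of_set {0..1}) (\<lambda>y. y ?f)"
    unfolding stone_cech_def unit_cube_def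
    by (intro continuous_map_from_subtopology continuous_map_product_projection f)
  show "stone_cech_embed Z x ?f = f x" if "x \<in> topspace Z" for x
    using f that by (simp add: stone_cech_embed_def)
qed

end

theory Submission
  imports Defs
begin

text \<open>
  The space \<open>\<beta>\<rat> \<setminus> {p}\<close> is cellular-compact because choosing a rational in each member of a
  disjoint open family gives a relatively discrete, hence nowhere dense, subset of \<open>\<rat>\<close>; its closure
  in \<open>\<beta>\<rat>\<close> is compact and misses \<open>p\<close>. In the product, the open sets \<open>U\<^sub>n \<times> {n}\<close>, for a countable
  \<open>\<pi>\<close>-base \<open>(U\<^sub>n)\<close> of \<open>\<beta>\<rat>\<close>, are disjoint, but the projection of a compact set to the first factor
  misses a neighbourhood of \<open>p\<close>, hence some \<open>U\<^sub>n\<close>.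
\<close>

text \<open>If the closure of \<open>D\<close> had nonempty interior \<open>?V\<close>, then
  \<open>D\<close> would be dense in \<open>?V\<close> and contain some \<open>d\<close> there. With
  \<open>G\<close> isolating \<open>d\<close> in \<open>D\<close>, the set
  \<open>G \<inter> ?V - {d}\<close> is open by T1 and misses \<open>D\<close>, so it is empty; thus
  \<open>{d}\<close> is open, against crowdedness.\<close>

lemma nowhere_dense_in_discrete_subset:
  assumes "t1_space Z" and crowded: "\<And>x. \<not> openin Z {x}" and "D \<subseteq> topspace Z"
    and discrete: "\<And>x. x \<in> D \<Longrightarrow> \<exists>G. openin Z G \<and> G \<inter> D = {x}"
  shows "nowhere_dense_in Z D"
proof -
  have False if x: "x \<in> Z interior_of (Z closure_of D)" for x
  proof -
    let ?V = "Z interior_of (Z closure_of D)"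
    have meets: "D \<inter> T \<noteq> {}" if "openin Z T" "T \<subseteq> ?V" "T \<noteq> {}" for T
      using that interior_of_subset [of Z "Z closure_of D"] openin_Int_closure_of_eq_empty [of Z T D]
      by blast
    obtain d where d: "d \<in> D" "d \<in> ?V"
      using meets [of ?V] x by auto
    obtain G where G: "openin Z G" "G \<inter> D = {d}"
      using discrete d by blast
    have GV: "openin Z (G \<inter> ?V)"
      using G by (simp add: openin_Int)
    then have "openin Z (G \<inter> ?V - {d})"
      using \<open>t1_space Z\<close> t1_space_openin_delete_alt by metis
    moreover have "D \<inter> (G \<inter> ?V - {d}) = {}"
      using G by blast
    ultimately have "G \<inter> ?V = {d}"
      using meets [of "G \<inter> ?V - {d}"] G d by blast
    then show False
      using crowded [of d] GV by simp
  qed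
  then show ?thesis
    using \<open>D \<subseteq> topspace Z\<close> by (auto simp: nowhere_dense_in_def)
qed

lemma not_openin_rat_space_singleton: "\<not> openin rat_space {x}"
proof
  assume "openin rat_space {x}"
  then obtain T where T: "open T" "{x} = \<rat> \<inter> T"
    by (auto simp: openin_open)
  then obtain e where e: "e > 0" "ball x e \<subseteq> T"
    using open_contains_ball by blast
  obtain q where "q \<in> \<rat>" "x < q" "q < x + e"
    using Rats_dense_in_real [of x "x + e"] e by auto
  then have "q \<in> \<rat> \<inter> T"
    using e by (auto simp: dist_real_def)
  then show False
    using T \<open>x < q\<close> by (metis less_irrefl singletonD)
qed

text \<open>Only the dense subspace has a countable base, so its members are lifted to open sets of
  \<open>X\<close>. By density a lifted set lies in the closure of its trace on \<open>D\<close>,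
  and regularity keeps that closure inside a given open set.\<close>

lemma countable_pi_base_of_dense_second_countable:
  assumes "regular_space X" and "second_countable (subtopology X D)"
    and dense: "X closure_of D = topspace X" and "D \<subseteq> topspace X"
  obtains \<B> where "countable \<B>" "\<And>U. U \<in> \<B> \<Longrightarrow> openin X U \<and> U \<inter> D \<noteq> {}"
    "\<And>W. openin X W \<Longrightarrow> W \<noteq> {} \<Longrightarrow> \<exists>U\<in>\<B>. U \<subseteq> W"
proof -
  obtain \<C> where \<C>: "countable \<C>" "\<And>B. B \<in> \<C> \<Longrightarrow> openin (subtopology X D) B"
    and base: "\<And>U x. openin (subtopology X D) U \<Longrightarrow> x \<in> U \<Longrightarrow> \<exists>B\<in>\<C>. x \<in> B \<and> B \<subseteq> U"
    using assms(2) unfolding second_countable_def by metis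
  then obtain f where f: "\<And>B. B \<in> \<C> \<Longrightarrow> openin X (f B) \<and> B = f B \<inter> D"
    unfolding openin_subtopology by metis
  show thesis
  proof
    \<comment> \<open>The empty trace is dropped so that every lifted set meets
      \<open>D\<close>.\<close>
    show "countable (f ` (\<C> - {{}}))"
      using \<C>(1) by blast
    show "openin X U \<and> U \<inter> D \<noteq> {}" if "U \<in> f ` (\<C> - {{}})" for U
      using that f by blast
    show "\<exists>U\<in>f ` (\<C> - {{}}). U \<subseteq> W" if "openin X W" "W \<noteq> {}" for W
    proof -
      obtain w where "w \<in> W"
        using \<open>W \<noteq> {}\<close> by blast
      with \<open>openin X W\<close> obtain V C where V: "openin X V" "closedin X C" "w \<in> V" "V \<subseteq> C" "C \<subseteq> W"
        using \<open>regular_space X\<close> neighbourhood_base_of_closedin neighbourhood_base_of by metis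
      then obtain x where x: "x \<in> V \<inter> D"
        using dense dense_intersects_open [of X D] V by blast
      then obtain B where B: "B \<in> \<C>" "x \<in> B" "B \<subseteq> V \<inter> D"
        using base [of "V \<inter> D" x] V by (auto simp: openin_subtopology)
      have "f B \<subseteq> X closure_of (f B \<inter> D)"
        using f [OF B(1)] openin_Int_closure_of_subset [of X "f B" D] dense openin_subset [of X "f B"]
        by auto
      also have "\<dots> \<subseteq> C"
        using f [OF B(1)] B V by (intro closure_of_minimal) auto
      finally show ?thesis
        using B V by blast
    qed
  qed
qed

lemma second_countable_euclidean:
  "second_countable (euclidean :: 'a::second_countable_topology topology)"
proof -
  obtain \<B> :: "'a set set" where \<B>: "countable \<B>" "topological_basis \<B>"
    using ex_countable_basis by blast
  then show ?thesis
    unfolding second_countable_def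
    by (intro exI [of _ \<B>]) (metis open_openin topological_basisE topological_basis_open)
qed

theorem theorem2p2:
  fixes p :: "(real \<Rightarrow> real) \<Rightarrow> real"
  assumes "remote_point rat_space p"
  defines "X \<equiv> subtopology (stone_cech rat_space) (topspace (stone_cech rat_space) - {p})"
      and "Y \<equiv> Alexandroff_compactification (discrete_topology (UNIV :: nat set))"
  shows "cellular_compact_space X \<and> \<not> cellular_compact_space (prod_topology X Y)"
proof
  define \<beta> where "\<beta> = stone_cech rat_space"
  define e where "e = stone_cech_embed rat_space"
  have emb: "embedding_map rat_space \<beta> e"
    unfolding \<beta>_def e_def
    by (intro embedding_map_stone_cech_embed metrizable_imp_completely_regular_space
        metrizable_space_subtopology metrizable_space_euclidean Hausdorff_space_subtopology) auto
  have cont: "continuous_map rat_space \<beta> e"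
    using emb homeomorphic_imp_continuous_map continuous_map_in_subtopology
    unfolding embedding_map_def by blast
  have img: "e ` \<rat> \<subseteq> topspace \<beta>"
    using continuous_map_image_subset_topspace [OF cont] by simp
  have dense: "\<beta> closure_of (e ` \<rat>) = topspace \<beta>"
    using stone_cech_embed_dense [of rat_space] by (simp add: \<beta>_def e_def)
  have Haus: "Hausdorff_space \<beta>" and comp: "compact_space \<beta>"
    by (simp_all add: \<beta>_def Hausdorff_space_stone_cech compact_space_stone_cech)
  have p: "p \<in> topspace \<beta>" "p \<notin> e ` \<rat>"
    and remote: "\<And>N. nowhere_dense_in rat_space N \<Longrightarrow> p \<notin> \<beta> closure_of (e ` N)"
    using assms(1) by (auto simp: remote_point_def \<beta>_def e_def)
  have X: "X = subtopology \<beta> (topspace \<beta> - {p})"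
    by (simp add: X_def \<beta>_def)
  have delete: "openin \<beta> (U - {p})" if "openin \<beta> U" for U
    using that Haus Hausdorff_imp_t1_space t1_space_openin_delete_alt by metis
  \<comment> \<open>Points are closed in \<open>\<beta>\<close>, so \<open>X\<close> is an open
    subspace and its open sets are open in \<open>\<beta>\<close>.\<close>
  have open_X: "openin X U \<longleftrightarrow> openin \<beta> U \<and> p \<notin> U" for U
    using openin_open_subtopology [OF delete [OF openin_topspace], of U] openin_subset [of \<beta> U]
    by (auto simp: X)
  have compact_X: "compactin X K \<longleftrightarrow> compactin \<beta> K \<and> p \<notin> K" for K
    using compactin_subset_topspace [of \<beta> K] by (auto simp: X compactin_subtopology)
  show "cellular_compact_space X"
    unfolding cellular_compact_space_def
  proof (intro allI impI, elim conjE)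
    fix \<U> assume \<U>: "\<forall>U\<in>\<U>. openin X U \<and> U \<noteq> {}" and disj: "pairwise disjnt \<U>"
    have "e ` \<rat> \<inter> U \<noteq> {}" if "U \<in> \<U>" for U
      using that \<U> dense dense_intersects_open [of \<beta> "e ` \<rat>"] open_X by simp
    then have "\<exists>q\<in>\<rat>. e q \<in> U" if "U \<in> \<U>" for U
      using that by blast
    then obtain g where g: "\<And>U. U \<in> \<U> \<Longrightarrow> g U \<in> \<rat> \<and> e (g U) \<in> U"
      by metis
    have "nowhere_dense_in rat_space (g ` \<U>)"
    proof (rule nowhere_dense_in_discrete_subset)
      show "t1_space rat_space"
        by (simp add: Hausdorff_imp_t1_space Hausdorff_space_subtopology)
      show "g ` \<U> \<subseteq> topspace rat_space"
        using g by auto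
      fix x assume "x \<in> g ` \<U>"
      then obtain U where U: "U \<in> \<U>" "x = g U" by blast
      \<comment> \<open>The preimage of \<open>U\<close> isolates \<open>g U\<close>: another chosen
        point in it would come from a member of the family meeting \<open>U\<close>.\<close>
      have "openin rat_space {q \<in> topspace rat_space. e q \<in> U}"
        using U \<U> open_X by (intro openin_continuous_map_preimage [OF cont]) simp
      moreover have "{q \<in> topspace rat_space. e q \<in> U} \<inter> g ` \<U> = {x}"
      proof -
        have "V = U" if "V \<in> \<U>" "e (g V) \<in> U" for V
          using pairwiseD [OF disj \<open>V \<in> \<U>\<close> U(1)] g [OF \<open>V \<in> \<U>\<close>] that by (auto simp: disjnt_iff)
        then show ?thesis
          using U g by auto
      qed
      ultimately show "\<exists>G. openin rat_space G \<and> G \<inter> g ` \<U> = {x}"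
        by blast
    qed (rule not_openin_rat_space_singleton)
    \<comment> \<open>Remoteness enters here: the closure, compact in \<open>\<beta>\<close>, avoids
      \<open>p\<close> and so stays compact in \<open>X\<close>.\<close>
    then have "compactin X (\<beta> closure_of (e ` g ` \<U>))"
      using remote comp by (simp add: compact_X closedin_compact_space)
    moreover have "\<beta> closure_of (e ` g ` \<U>) \<inter> U \<noteq> {}" if "U \<in> \<U>" for U
    proof -
      have "e ` g ` \<U> \<subseteq> \<beta> closure_of (e ` g ` \<U>)"
        using g img by (intro closure_of_subset) blast
      then show ?thesis
        using that g by blast
    qed
    ultimately show "\<exists>K. compactin X K \<and> (\<forall>U\<in>\<U>. K \<inter> U \<noteq> {})"
      by blast
  qed
  show "\<not> cellular_compact_space (prod_topology X Y)"
  proof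
    assume cc: "cellular_compact_space (prod_topology X Y)"
    have "subtopology \<beta> (e ` \<rat>) homeomorphic_space rat_space"
      using emb
        by (metis embedding_map_imp_homeomorphic_space homeomorphic_space_sym
            topspace_euclidean_subtopology)
    then have "second_countable (subtopology \<beta> (e ` \<rat>))"
      using second_countable_subtopology [OF second_countable_euclidean]
        homeomorphic_space_second_countability by blast
    then obtain \<B> where \<B>: "countable \<B>" "\<And>U. U \<in> \<B> \<Longrightarrow> openin \<beta> U \<and> U \<inter> e ` \<rat> \<noteq> {}"
      and pi: "\<And>W. openin \<beta> W \<Longrightarrow> W \<noteq> {} \<Longrightarrow> \<exists>U\<in>\<B>. U \<subseteq> W"
      using countable_pi_base_of_dense_second_countable [OF _ _ dense img]
        compact_Hausdorff_imp_regular_space [OF comp Haus] by metis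
    define h where "h U = (U - {p}) \<times> {Some (to_nat_on \<B> U)}" for U
    have "openin (prod_topology X Y) (h U) \<and> h U \<noteq> {}" if "U \<in> \<B>" for U
    proof -
      have "openin X (U - {p})"
        using \<B>(2) [OF that] delete by (simp add: open_X)
      moreover have "openin Y {Some (to_nat_on \<B> U)}"
        using openin_Alexandroff_compactification_image_Some [of _ "{to_nat_on \<B> U}"]
        by (simp add: Y_def)
      ultimately show ?thesis
        using \<B>(2) [OF that] p by (auto simp: h_def openin_prod_Times_iff)
    qed
    moreover have "pairwise disjnt (h ` \<B>)"
      using inj_on_to_nat_on [OF \<B>(1)] by (auto simp: pairwise_def disjnt_iff h_def inj_on_def)
    ultimately obtain K where K: "compactin (prod_topology X Y) K" "\<And>U. U \<in> \<B> \<Longrightarrow> K \<inter> h U \<noteq> {}"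
      using cc unfolding cellular_compact_space_def by (metis (no_types, lifting) image_iff)
    then have "compactin X (fst ` K)"
      using image_compactin continuous_map_fst by blast
    \<comment> \<open>The projection of \<open>K\<close> is closed in \<open>\<beta>\<close>. Its
      complement contains \<open>p\<close>, hence is nonempty and includes a \<pi>-base member
      \<open>U\<close>; then \<open>K\<close> cannot meet \<open>h U\<close>.\<close>
    then have "openin \<beta> (topspace \<beta> - fst ` K)" "p \<notin> fst ` K"
      using Haus by (auto simp: compact_X compactin_imp_closedin)
    then obtain U where "U \<in> \<B>" "U \<subseteq> topspace \<beta> - fst ` K"
      using pi p by blast
    then show False
      using K(2) [of U] by (force simp: h_def)
  qed
qed

end
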